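(* Let $\Omega\subset\mathbb{R}^n$ be compact, $f\in C(\Omega)$ real-valued with global minimum value $f^*=\min_{x\in\Omega}f(x)$, $\rho:\mathbb{R}\to\mathbb{R}$ monotonically (strictly) decreasing with $\rho(f(x))>0$ for every $x\in\Omega$, $\tau(x)=\rho(f(x))$, and $m^{(k)}(x)=\tau^k(x)/\int_\Omega\tau^k(t)\,\mathrm{d}t$ for $x\in\Omega$, $k\in\mathbb{R}$. For all $k\in\mathbb{R}$ and $\Delta k>0$, $$\int_\Omega f(x)\,m^{(k)}(x)\,\mathrm{d}x\geqslant\int_\Omega f(x)\,m^{(k+\Delta k)}(x)\,\mathrm{d}x\geqslant f^*;$$ further, if $\tau=e^{-f}$ and $f$ is not a constant function on $\Omega$, then for all $k\in\mathbb{R}$ and $\Delta k>0$, $$\int_\Omega f(x)\,m^{(k)}(x)\,\mathrm{d}x>\int_\Omega f(x)\,m^{(k+\Delta k)}(x)\,\mathrm{d}x>f^*.$$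
   Context: Integrals are with respect to $n$-dimensional Lebesgue measure $\mu$; it is implicit in the definition of $m^{(k)}$ that $\mu(\Omega)>0$.
   Formalization: In the strict part, "f is not a constant function on Ω" is replaced by "f is not almost everywhere equal to a constant on Ω"; as stated it fails, e.g. for Ω = [0,1]∪{2}, f = 0 on [0,1], f(2) = 1, where all integrals equal f* = 0. *)

theory Defs
  imports "HOL-Analysis.Analysis"
begin

definition min_value :: "('a \<Rightarrow> real) \<Rightarrow> 'a set \<Rightarrow> real" where
  "min_value f S = (LEAST y. y \<in> f ` S)"

text \<open>
  The density \<open>m\<^sup>(\<^sup>k\<^sup>)\<close> on \<open>\<Omega>\<close>; only its values on \<open>\<Omega>\<close> are meaningful.  The
  exponent is real, hence \<open>powr\<close>, which is the usual power as long as \<open>\<tau>\<close> is positive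
  on \<open>\<Omega>\<close>.
\<close>

definition minima_density ::
    "(real ^ 'n) set \<Rightarrow> (real ^ 'n \<Rightarrow> real) \<Rightarrow> real \<Rightarrow> real ^ 'n \<Rightarrow> real" where
  "minima_density \<Omega> \<tau> k x = \<tau> x powr k / (LINT t:\<Omega>|lebesgue. \<tau> t powr k)"

text \<open>
  Being non-constant is understood up to Lebesgue null sets.  Pointwise non-constancy
  would not give strict inequalities between integrals: on \<open>[0,1] \<union> {2}\<close>, the continuous
  function that is \<open>0\<close> on \<open>[0,1]\<close> and \<open>1\<close> at \<open>2\<close> has all the integrals equal to its
  minimum \<open>0\<close>.
\<close>

definition ae_constant_on :: "(real ^ 'n \<Rightarrow> real) \<Rightarrow> (real ^ 'n) set \<Rightarrow> bool" where
  "ae_constant_on f \<Omega> \<longleftrightarrow> (\<exists>c. AE x\<in>\<Omega> in lebesgue. f x = c)"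

end

theory Submission
  imports Defs
begin

text \<open>
  Let \<open>E\<close> be the mean of \<open>f\<close> with respect to the weight \<open>u = \<tau>\<^sup>k\<close>.  Multiplying the weight
  by \<open>g = \<tau>\<^sup>\<Delta>\<^sup>k\<close>, a decreasing function of \<open>f\<close> with value \<open>c\<close> at level \<open>E\<close>, gives
  \<open>(f - E) (g - c) \<le> 0\<close> pointwise, hence \<open>\<integral> (f - E) u g \<le> c \<integral> (f - E) u = 0\<close>.  This says that
  the mean with weight \<open>u g\<close> is at most \<open>E\<close>; equality forces \<open>f = E\<close> almost everywhere.
\<close>

text \<open>Expectation of \<open>f\<close> under the density \<open>u\<close> divided by its total
  mass. The measure is arbitrary, so that \<open>\<Omega>\<close> can be absorbed into it.\<close>

definition weighted_mean :: "'a measure \<Rightarrow> ('a \<Rightarrow> real) \<Rightarrow> ('a \<Rightarrow> real) \<Rightarrow> real" where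
  "weighted_mean M u f = (\<integral>x. f x * u x \<partial>M) / (\<integral>x. u x \<partial>M)"

text \<open>A nonnegative integrand with zero integral vanishes almost everywhere; a positive one
  can do so only on a null space. This makes the denominators of all the means positive.\<close>

lemma integral_pos_of_pos:
  fixes u :: "'a \<Rightarrow> real"
  assumes "integrable M u" and pos: "\<And>x. x \<in> space M \<Longrightarrow> 0 < u x"
    and "emeasure M (space M) \<noteq> 0"
  shows "0 < (\<integral>x. u x \<partial>M)"
proof -
  have nonneg: "AE x in M. 0 \<le> u x"
    using pos by (auto intro!: AE_I2 less_imp_le)
  have "\<not> (AE x in M. u x = 0)"
  proof
    assume "AE x in M. u x = 0"
    then have "AE x in M. False"
      using AE_space by eventually_elim (use pos in force)
    then show False
      using assms(3) by (simp add: AE_iff_measurable[where N = "space M"])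
  qed
  moreover have "0 \<le> (\<integral>x. u x \<partial>M)"
    using nonneg by (rule integral_nonneg_AE)
  ultimately show ?thesis
    using integral_nonneg_eq_0_iff_AE[OF assms(1) nonneg] by linarith
qed

text \<open>The nonnegative function \<open>(f x - a) * u x\<close> has integral mean minus
  \<open>a\<close>, times the total weight. If the mean equals \<open>a\<close>, this function is
  zero almost everywhere, and dividing by \<open>u x > 0\<close> gives
  \<open>f x = a\<close>.\<close>

lemma weighted_mean_ge:
  fixes f u :: "'a \<Rightarrow> real"
  assumes "integrable M u" and "integrable M (\<lambda>x. f x * u x)"
    and pos: "\<And>x. x \<in> space M \<Longrightarrow> 0 < u x"
    and "emeasure M (space M) \<noteq> 0"
    and lower: "\<And>x. x \<in> space M \<Longrightarrow> a \<le> f x"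
  shows "a \<le> weighted_mean M u f"
    and "weighted_mean M u f = a \<Longrightarrow> AE x in M. f x = a"
proof -
  note U = integral_pos_of_pos[OF assms(1) pos assms(4)]
  have int: "integrable M (\<lambda>x. (f x - a) * u x)"
    using assms(1,2) by (simp add: left_diff_distrib)
  have eq: "(\<integral>x. (f x - a) * u x \<partial>M) = (weighted_mean M u f - a) * (\<integral>x. u x \<partial>M)"
    using assms(1,2) U by (simp add: weighted_mean_def left_diff_distrib)
  have nonneg: "AE x in M. 0 \<le> (f x - a) * u x"
    using pos lower by (auto intro!: AE_I2 mult_nonneg_nonneg less_imp_le[OF pos])
  show "a \<le> weighted_mean M u f"
    using integral_nonneg_AE[OF nonneg] U unfolding eq by (simp add: zero_le_mult_iff)
  assume "weighted_mean M u f = a"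
  then have "AE x in M. (f x - a) * u x = 0"
    using integral_nonneg_eq_0_iff_AE[OF int nonneg] eq by simp
  then show "AE x in M. f x = a"
    using AE_space by eventually_elim (use pos in force)
qed

lemma weighted_mean_le:
  fixes f u :: "'a \<Rightarrow> real"
  assumes "integrable M u" and "integrable M (\<lambda>x. f x * u x)"
    and "\<And>x. x \<in> space M \<Longrightarrow> 0 < u x"
    and "emeasure M (space M) \<noteq> 0"
    and "\<And>x. x \<in> space M \<Longrightarrow> f x \<le> b"
  shows "weighted_mean M u f \<le> b"
  using weighted_mean_ge(1)[of M u "\<lambda>x. - f x" "- b"] assms
  by (simp add: weighted_mean_def)

text \<open>The constant \<open>c\<close> separates the values of \<open>g\<close> below the level
  \<open>E\<close> of \<open>f\<close> from those above it; this is how \<open>g\<close> being a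
  decreasing function of \<open>f\<close> enters.\<close>

lemma weighted_mean_mult_le:
  fixes M :: "'a measure" and f g u :: "'a \<Rightarrow> real"
  defines "E \<equiv> weighted_mean M u f"
  assumes "integrable M u" and "integrable M (\<lambda>x. f x * u x)"
    and "integrable M (\<lambda>x. u x * g x)" and "integrable M (\<lambda>x. f x * (u x * g x))"
    and u: "\<And>x. x \<in> space M \<Longrightarrow> 0 < u x" and g: "\<And>x. x \<in> space M \<Longrightarrow> 0 < g x"
    and "emeasure M (space M) \<noteq> 0"
    and below: "\<And>x. x \<in> space M \<Longrightarrow> f x < E \<Longrightarrow> c < g x"
    and above: "\<And>x. x \<in> space M \<Longrightarrow> E < f x \<Longrightarrow> g x < c"
  shows "weighted_mean M (\<lambda>x. u x * g x) f \<le> E"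
    and "weighted_mean M (\<lambda>x. u x * g x) f = E \<Longrightarrow> AE x in M. f x = E"
proof -
  let ?h = "\<lambda>x. (E - f x) * (g x - c) * u x"
  have U: "0 < (\<integral>x. u x \<partial>M)"
    using assms(2) u assms(8) by (rule integral_pos_of_pos)
  have V: "0 < (\<integral>x. u x * g x \<partial>M)"
    using assms(4) _ assms(8) by (rule integral_pos_of_pos) (simp add: u g)
  \<comment> \<open>Grouped so that each summand is integrable by assumption. The bracket multiplied
    by \<open>c\<close> integrates to 0 by the choice of \<open>E\<close>, so only the terms with
    weight \<open>u x * g x\<close> survive.\<close>
  have expand: "?h = (\<lambda>x. E * (u x * g x) - f x * (u x * g x) - c * (E * u x - f x * u x))"
    by (auto simp: algebra_simps)
  have int: "integrable M ?h"
    unfolding expand using assms(2-5) by simp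
  have "(\<integral>x. f x * u x \<partial>M) = E * (\<integral>x. u x \<partial>M)"
    using U by (simp add: E_def weighted_mean_def)
  then have eq: "integral\<^sup>L M ?h
      = (E - weighted_mean M (\<lambda>x. u x * g x) f) * (\<integral>x. u x * g x \<partial>M)"
    unfolding expand using assms(2-5) V by (simp add: weighted_mean_def left_diff_distrib)
  have sign: "0 \<le> ?h x" "?h x = 0 \<Longrightarrow> f x = E" if "x \<in> space M" for x
  proof -
    \<comment> \<open>Off the level \<open>E\<close> both factors are nonzero and have the same
      sign; on it the first factor is 0, whatever \<open>g x\<close> is.\<close>
    have "f x = E \<or> 0 < (E - f x) * (g x - c)"
      using below[OF that] above[OF that]
      by (cases "f x" E rule: linorder_cases) (simp_all add: mult_neg_neg)
    then show "0 \<le> ?h x" "?h x = 0 \<Longrightarrow> f x = E"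
      using u[OF that] by auto
  qed
  have nonneg: "AE x in M. 0 \<le> ?h x"
    using sign(1) by (rule AE_I2)
  show "weighted_mean M (\<lambda>x. u x * g x) f \<le> E"
    using integral_nonneg_AE[OF nonneg] V unfolding eq by (simp add: zero_le_mult_iff)
  assume "weighted_mean M (\<lambda>x. u x * g x) f = E"
  then have "AE x in M. ?h x = 0"
    using integral_nonneg_eq_0_iff_AE[OF int nonneg] eq by simp
  then show "AE x in M. f x = E"
    using AE_space by eventually_elim (use sign in blast)
qed

lemma borel_measurable_antimono:
  fixes \<rho> :: "real \<Rightarrow> real"
  assumes "antimono \<rho>"
  shows "\<rho> \<in> borel_measurable borel"
proof -
  have "(\<lambda>x. - \<rho> x) \<in> borel_measurable borel"
    using assms by (intro borel_measurable_mono) (auto simp: monotone_on_def)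
  then show ?thesis
    by simp
qed

context finite_measure
begin

text \<open>Raising the exponent by \<open>d\<close> multiplies the weight by
  \<open>\<rho> (f x) powr d\<close>, a decreasing function of \<open>f\<close>, so the previous
  comparison applies. Positivity of \<open>\<rho>\<close> at the upper bound \<open>b\<close> of
  \<open>f\<close> spreads to all values of \<open>f\<close> by monotonicity.\<close>

lemma weighted_mean_antimono_powr:
  fixes f :: "'a \<Rightarrow> real" and \<rho> :: "real \<Rightarrow> real"
  assumes f: "f \<in> borel_measurable M"
    and a: "\<And>x. x \<in> space M \<Longrightarrow> a \<le> f x" and b: "\<And>x. x \<in> space M \<Longrightarrow> f x \<le> b"
    and \<rho>: "strict_antimono_on UNIV \<rho>" and "0 < \<rho> b"
    and space: "emeasure M (space M) \<noteq> 0" and "0 < d"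
  defines "mean \<equiv> \<lambda>k. weighted_mean M (\<lambda>x. \<rho> (f x) powr k) f"
  shows "a \<le> mean k" and "mean (k + d) \<le> mean k"
    and "\<not> (\<exists>c. AE x in M. f x = c) \<Longrightarrow> a < mean k"
    and "\<not> (\<exists>c. AE x in M. f x = c) \<Longrightarrow> mean (k + d) < mean k"
proof -
  have strict: "\<rho> y < \<rho> x" if "x < y" for x y
    using \<rho> that by (auto simp: monotone_on_def)
  have anti: "\<rho> y \<le> \<rho> x" if "x \<le> y" for x y
    using strict[of x y] that by (cases "x = y") auto
  have [measurable]: "\<rho> \<in> borel_measurable borel"
    using anti by (intro borel_measurable_antimono) (auto simp: monotone_on_def)
  note f[measurable]
  have \<rho>_pos: "0 < \<rho> y" if "y \<le> b" for y
    using anti[OF that] \<open>0 < \<rho> b\<close> by linarith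
  \<comment> \<open>The power increases or decreases in its base according to the sign of
    \<open>j\<close>; the sum of the two end values dominates in both cases.\<close>
  have bound: "\<rho> (f x) powr j \<le> \<rho> a powr j + \<rho> b powr j" if "x \<in> space M" for x j
  proof (cases "0 \<le> j")
    case True
    have "\<rho> (f x) powr j \<le> \<rho> a powr j"
      using True \<rho>_pos[OF b[OF that]] anti[OF a[OF that]] by (intro powr_mono2) auto
    then show ?thesis
      using powr_ge_zero[of "\<rho> b" j] by linarith
  next
    case False
    have "\<rho> (f x) powr j \<le> \<rho> b powr j"
      using False \<open>0 < \<rho> b\<close> anti[OF b[OF that]] by (intro powr_mono2') auto
    then show ?thesis
      using powr_ge_zero[of "\<rho> a" j] by linarith
  qed
  have int: "integrable M (\<lambda>x. \<rho> (f x) powr j)" for j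
    by (rule integrable_const_bound[where B = "\<rho> a powr j + \<rho> b powr j"])
      (auto intro!: AE_I2 bound)
  have intf: "integrable M (\<lambda>x. f x * \<rho> (f x) powr j)" for j
  proof (rule integrable_const_bound[where B = "(\<bar>a\<bar> + \<bar>b\<bar>) * (\<rho> a powr j + \<rho> b powr j)"])
    have "\<bar>f x\<bar> \<le> \<bar>a\<bar> + \<bar>b\<bar>" if "x \<in> space M" for x
      using a[OF that] b[OF that] by linarith
    then show "AE x in M. norm (f x * \<rho> (f x) powr j)
        \<le> (\<bar>a\<bar> + \<bar>b\<bar>) * (\<rho> a powr j + \<rho> b powr j)"
      by (auto intro!: AE_I2 mult_mono bound simp: abs_mult)
  qed measurable
  have pos: "0 < \<rho> (f x) powr j" if "x \<in> space M" for x j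
    using \<rho>_pos[OF b[OF that]] by simp
  \<comment> \<open>The separating constant will be \<open>\<rho> (mean k) powr d\<close>. Comparing
    powers requires a nonnegative base, and \<open>\<rho>\<close> is known to be positive only up to
    \<open>b\<close>.\<close>
  have "mean k \<le> b"
    unfolding mean_def by (intro weighted_mean_le int intf pos space b)
  then have \<rho>_mean: "0 < \<rho> (mean k)"
    by (rule \<rho>_pos)
  have split: "(\<lambda>x. \<rho> (f x) powr (k + d)) = (\<lambda>x. \<rho> (f x) powr k * \<rho> (f x) powr d)"
    by (simp add: powr_add)
  have below: "\<rho> (mean k) powr d < \<rho> (f x) powr d" if "x \<in> space M" "f x < mean k" for x
    using \<rho>_mean strict[OF that(2)] \<open>0 < d\<close> by (intro powr_less_mono2) auto
  have above: "\<rho> (f x) powr d < \<rho> (mean k) powr d" if "x \<in> space M" "mean k < f x" for x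
    using \<rho>_pos[OF b[OF that(1)]] strict[OF that(2)] \<open>0 < d\<close> by (intro powr_less_mono2) auto
  have int': "integrable M (\<lambda>x. \<rho> (f x) powr k * \<rho> (f x) powr d)"
    and intf': "integrable M (\<lambda>x. f x * (\<rho> (f x) powr k * \<rho> (f x) powr d))"
    using int[of "k + d"] intf[of "k + d"] by (simp_all add: powr_add)
  show ge: "a \<le> mean k"
    unfolding mean_def by (intro weighted_mean_ge int intf pos space a)
  show le: "mean (k + d) \<le> mean k"
    unfolding mean_def split
    by (rule weighted_mean_mult_le(1)[where c = "\<rho> (mean k) powr d", unfolded mean_def])
      (fact int intf int' intf' pos space below[unfolded mean_def] above[unfolded mean_def])+
  \<comment> \<open>Strictness by contraposition: equality in either estimate makes \<open>f\<close>
    constant almost everywhere, with value \<open>a\<close> or \<open>mean k\<close>.\<close>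
  have "AE x in M. f x = a" if "mean k = a"
    by (rule weighted_mean_ge(2)[OF int intf pos space a that[unfolded mean_def]])
  moreover have "AE x in M. f x = mean k" if "mean (k + d) = mean k"
    unfolding mean_def
    by (rule weighted_mean_mult_le(2)[where c = "\<rho> (mean k) powr d", unfolded mean_def])
      (fact int intf int' intf' pos space below[unfolded mean_def] above[unfolded mean_def]
        that[unfolded mean_def split])+
  ultimately show "a < mean k" "mean (k + d) < mean k" if "\<not> (\<exists>c. AE x in M. f x = c)"
    using that ge le by (metis order.not_eq_order_implies_strict)+
qed

end

lemma min_value_eq:
  fixes f :: "'a \<Rightarrow> real"
  assumes "x \<in> S" and "\<And>y. y \<in> S \<Longrightarrow> f x \<le> f y"
  shows "min_value f S = f x"
  unfolding min_value_def using assms by (intro Least_equality) auto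

text \<open>The normalising integral is a constant factor and comes out of the integral. Passing
  from \<open>\<tau>\<close> to \<open>s\<close>, later \<open>\<rho> (f x)\<close>, is harmless
  because both are integrated over \<open>\<Omega>\<close> only.\<close>

lemma integral_minima_density:
  fixes \<Omega> :: "(real ^ 'n) set"
  assumes "\<Omega> \<in> sets lebesgue" and "\<And>x. x \<in> \<Omega> \<Longrightarrow> \<tau> x = s x"
  shows "(LINT x:\<Omega>|lebesgue. f x * minima_density \<Omega> \<tau> k x)
    = weighted_mean (lebesgue_on \<Omega>) (\<lambda>x. s x powr k) f"
proof -
  have restrict: "(LINT x:\<Omega>|lebesgue. h x) = integral\<^sup>L (lebesgue_on \<Omega>) h"
    for h :: "real ^ 'n \<Rightarrow> real"
    using assms(1) by (simp add: set_lebesgue_integral_def integral_restrict_space)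
  have "(\<integral>x. \<tau> x powr k \<partial>lebesgue_on \<Omega>) = (\<integral>x. s x powr k \<partial>lebesgue_on \<Omega>)"
    "(\<integral>x. f x * \<tau> x powr k \<partial>lebesgue_on \<Omega>) = (\<integral>x. f x * s x powr k \<partial>lebesgue_on \<Omega>)"
    by (auto intro!: Bochner_Integration.integral_cong simp: assms(2))
  then show ?thesis
    by (simp add: restrict minima_density_def weighted_mean_def)
qed

theorem corollary1:
  fixes \<Omega> :: "(real ^ 'n) set"
    and f \<tau> :: "real ^ 'n \<Rightarrow> real"
    and \<rho> :: "real \<Rightarrow> real"
  assumes "compact \<Omega>"
    and "emeasure lebesgue \<Omega> > 0"
    and "continuous_on \<Omega> f"
    and "strict_antimono_on UNIV \<rho>"
    and "\<forall>x\<in>\<Omega>. \<rho> (f x) > 0"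
    and "\<forall>x\<in>\<Omega>. \<tau> x = \<rho> (f x)"
  shows
    "(\<forall>k \<Delta>k. \<Delta>k > 0 \<longrightarrow>
        (LINT x:\<Omega>|lebesgue. f x * minima_density \<Omega> \<tau> k x)
          \<ge> (LINT x:\<Omega>|lebesgue. f x * minima_density \<Omega> \<tau> (k + \<Delta>k) x) \<and>
        (LINT x:\<Omega>|lebesgue. f x * minima_density \<Omega> \<tau> (k + \<Delta>k) x)
          \<ge> min_value f \<Omega>) \<and>
     ((\<forall>x\<in>\<Omega>. \<tau> x = exp (- f x)) \<and> \<not> ae_constant_on f \<Omega> \<longrightarrow>
      (\<forall>k \<Delta>k. \<Delta>k > 0 \<longrightarrow>
        (LINT x:\<Omega>|lebesgue. f x * minima_density \<Omega> \<tau> k x)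
          > (LINT x:\<Omega>|lebesgue. f x * minima_density \<Omega> \<tau> (k + \<Delta>k) x) \<and>
        (LINT x:\<Omega>|lebesgue. f x * minima_density \<Omega> \<tau> (k + \<Delta>k) x)
          > min_value f \<Omega>))"
proof -
  have meas: "\<Omega> \<in> sets lebesgue"
    using \<open>compact \<Omega>\<close> by (intro sets_completionI_sets) (simp add: compact_imp_closed)
  have "\<Omega> \<noteq> {}"
    using assms(2) by auto
  \<comment> \<open>The extreme values \<open>f p\<close> and \<open>f q\<close> serve as the bounds
    \<open>a\<close> and \<open>b\<close>: the former is \<open>min_value f \<Omega>\<close>, and
    \<open>\<rho>\<close> is positive at the latter because \<open>q\<close> lies in
    \<open>\<Omega>\<close>.\<close>
  then obtain p q where p: "p \<in> \<Omega>" "\<And>x. x \<in> \<Omega> \<Longrightarrow> f p \<le> f x"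
    and q: "q \<in> \<Omega>" "\<And>x. x \<in> \<Omega> \<Longrightarrow> f x \<le> f q"
    using continuous_attains_inf[OF assms(1) _ assms(3)]
      continuous_attains_sup[OF assms(1) _ assms(3)] by metis
  have min: "min_value f \<Omega> = f p"
    using p by (rule min_value_eq)
  interpret finite_measure "lebesgue_on \<Omega>"
    using lmeasurable_compact[OF assms(1)]
    by (rule finite_measure_lebesgue_on)
  have f: "f \<in> borel_measurable (lebesgue_on \<Omega>)"
    using assms(3) meas by (rule continuous_imp_measurable_on_sets_lebesgue)
  have space: "emeasure (lebesgue_on \<Omega>) (space (lebesgue_on \<Omega>)) \<noteq> 0"
    using assms(2) meas by (simp add: emeasure_restrict_space)
  have const: "ae_constant_on f \<Omega> \<longleftrightarrow> (\<exists>c. AE x in lebesgue_on \<Omega>. f x = c)"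
    using meas by (simp add: ae_constant_on_def AE_restrict_space_iff)
  have \<rho>q: "0 < \<rho> (f q)"
    using assms(5) q(1) by blast
  have integral: "(LINT x:\<Omega>|lebesgue. f x * minima_density \<Omega> \<tau> k x)
      = weighted_mean (lebesgue_on \<Omega>) (\<lambda>x. \<rho> (f x) powr k) f" for k
    using meas assms(6) by (intro integral_minima_density) auto
  note mean = weighted_mean_antimono_powr[where f = f and \<rho> = \<rho> and a = "f p" and b = "f q",
      OF f _ _ assms(4) \<rho>q space]
  show ?thesis
    \<comment> \<open>The bounds from below are the general ones taken at the exponent
      \<open>k + \<Delta>k\<close>.\<close>
    unfolding integral min const using p(2) q(2) by (auto intro!: mean)
qed

end
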